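(* $\mathsf{C}_\mathbb{N}\not\le_W\mathrm{Ind}\,\mathbb{Q}$.
   Context: A problem is a partial multivalued function $P\colon\subseteq\mathbb{N}^\mathbb{N}\rightrightarrows\mathbb{N}^\mathbb{N}$. $P\le_W Q$ means there are Turing functionals $\Delta,\Psi$ with $\Delta^p\in\mathrm{dom}\,Q$ for all $p\in\mathrm{dom}\,P$ and $\Psi^{p\oplus q}\in P(p)$ for all $q\in Q(\Delta^p)$. $\mathsf{C}_\mathbb{N}$: instances are enumerations of the complement of a nonempty set $A\subseteq\mathbb{N}$; solutions are elements of $A$. $\mathbb{Q}$ denotes the rationals as a linear order (the countable dense linear order without endpoints). $\mathrm{Ind}\,\mathbb{Q}$: instances are triples $\langle\mathcal{A},c,k\rangle$ where $\mathcal{A}$ is a presentation of $\mathbb{Q}$ and $c\colon\mathrm{dom}\,\mathcal{A}\to\{0,\dots,k-1\}$; solutions are sets $B\subseteq\mathrm{dom}\,\mathcal{A}$ monochromatic for $c$ whose induced suborder is isomorphic to $\mathbb{Q}$. *)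

theory Defs
  imports Complex_Main "HOL-Library.Nat_Bijection"
begin

type_synonym baire = "nat \<Rightarrow> nat"

definition join :: "baire \<Rightarrow> baire \<Rightarrow> baire" (infixr "\<oplus>\<^sub>B" 65) where
  "(p \<oplus>\<^sub>B q) n = (if even n then p (n div 2) else q (n div 2))"

subsection \<open>Turing functionals\<close>

text \<open>
  Turing functionals are given by the partial recursive functions relative to a function
  \<open>p\<close>: Kleene's schemes with one additional initial function \<open>Query\<close>, which returns
  the value of \<open>p\<close> at its argument.  Composition is strict, and \<open>Mu\<close> returns the least zero,
  provided that the function is defined at all smaller arguments.
\<close>

datatype prog =
    Zero
  | Succ
  | Proj nat
  | Query
  | Comp prog "prog list"
  | PrimRec prog prog
  | Mu prog

inductive eval :: "baire \<Rightarrow> prog \<Rightarrow> nat list \<Rightarrow> nat \<Rightarrow> bool" for p :: baire where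
  eval_Zero: "eval p Zero xs 0"
| eval_Succ: "eval p Succ [x] (Suc x)"
| eval_Proj: "i < length xs \<Longrightarrow> eval p (Proj i) xs (xs ! i)"
| eval_Query: "eval p Query [x] (p x)"
| eval_Comp: "list_all2 (\<lambda>g y. eval p g xs y) gs ys \<Longrightarrow> eval p f ys z
    \<Longrightarrow> eval p (Comp f gs) xs z"
| eval_PrimRec_0: "eval p f xs y \<Longrightarrow> eval p (PrimRec f g) (0 # xs) y"
| eval_PrimRec_Suc: "eval p (PrimRec f g) (n # xs) y \<Longrightarrow> eval p g (n # y # xs) z
    \<Longrightarrow> eval p (PrimRec f g) (Suc n # xs) z"
| eval_Mu: "eval p f (n # xs) 0 \<Longrightarrow> (\<forall>m<n. \<exists>y. eval p f (m # xs) (Suc y))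
    \<Longrightarrow> eval p (Mu f) xs n"

inductive_cases eval_cases:
  "eval p Zero xs z" "eval p Succ xs z" "eval p (Proj i) xs z" "eval p Query xs z"
  "eval p (Comp f gs) xs z" "eval p (PrimRec f g) (0 # xs) z"
  "eval p (PrimRec f g) (Suc n # xs) z" "eval p (Mu f) xs z"

lemma eval_deterministic: "eval p e xs y \<Longrightarrow> eval p e xs z \<Longrightarrow> y = z"
proof (induction arbitrary: z rule: eval.induct)
  case (eval_Comp xs gs ys f w)
  from eval_Comp.prems show ?case
  proof (rule eval_cases(5))
    fix vs assume vs: "list_all2 (\<lambda>g y. eval p g xs y) gs vs" and z: "eval p f vs z"
    have "ys = vs"
    proof (rule nth_equalityI)
      show "length ys = length vs"
        using list_all2_lengthD[OF eval_Comp.IH(1)] list_all2_lengthD[OF vs] by simp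
      fix i assume "i < length ys"
      then show "ys ! i = vs ! i"
        using eval_Comp.IH(1) vs unfolding list_all2_conv_all_nth by metis
    qed
    with eval_Comp.IH(2) z show ?case by blast
  qed
next
  case (eval_PrimRec_Suc f g n xs y w)
  from eval_PrimRec_Suc.prems show ?case
    by (rule eval_cases(7)) (use eval_PrimRec_Suc.IH in blast)
next
  case (eval_Mu f n xs)
  from eval_Mu.prems show ?case
  proof (rule eval_cases(8))
    assume z: "eval p f (z # xs) 0" "\<forall>m<z. \<exists>y. eval p f (m # xs) (Suc y)"
    have "\<not> z < n" using eval_Mu.IH(2) z(1) by (metis nat.distinct(1))
    moreover have "\<not> n < z" using eval_Mu.IH(1) z(2) by (metis nat.distinct(1))
    ultimately show "n = z" by simp
  qed
qed (blast elim: eval_cases)+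

text \<open>
  \<open>F p = Some f\<close> means that the functional applied to \<open>p\<close> is total with value \<open>f\<close>;
  \<open>F p = None\<close> means that it diverges at some argument.
\<close>

definition turing_functional :: "(baire \<rightharpoonup> baire) \<Rightarrow> bool" where
  "turing_functional F \<longleftrightarrow>
     (\<exists>e. \<forall>p f. F p = Some f \<longleftrightarrow> (\<forall>n. eval p e [n] (f n)))"

lemma turing_functional_ex:
  "\<exists>F. \<forall>p f. F p = Some f \<longleftrightarrow> (\<forall>n. eval p e [n] (f n))"
proof -
  define F where "F p = (if \<exists>f. \<forall>n. eval p e [n] (f n)
    then Some (\<lambda>n. THE y. eval p e [n] y) else None)" for p
  have "(\<lambda>n. THE y. eval p e [n] y) = f" if "\<forall>n. eval p e [n] (f n)" for p f
    using that by (intro ext the_equality) (auto intro: eval_deterministic)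
  then have "F p = Some f \<longleftrightarrow> (\<forall>n. eval p e [n] (f n))" for p f
    by (auto simp: F_def)
  then show ?thesis by blast
qed

subsection \<open>Problems and Weihrauch reducibility\<close>

text \<open>
  A partial multivalued function maps each instance in its domain to its set of solutions.
\<close>

type_synonym problem = "baire \<rightharpoonup> baire set"

definition weihrauch_le :: "problem \<Rightarrow> problem \<Rightarrow> bool" (infix "\<le>\<^sub>W" 50) where
  "P \<le>\<^sub>W Q \<longleftrightarrow>
     (\<exists>\<Delta> \<Psi>. turing_functional \<Delta> \<and> turing_functional \<Psi> \<and>
        (\<forall>p \<in> dom P. \<exists>d \<in> dom Q. \<Delta> p = Some d \<and>
           (\<forall>q \<in> the (Q d). \<exists>r \<in> the (P p). \<Psi> (p \<oplus>\<^sub>B q) = Some r)))"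

subsection \<open>Closed choice on the natural numbers\<close>

text \<open>
  The value \<open>Suc n\<close> puts \<open>n\<close> into the enumerated set, whereas the value \<open>0\<close> enumerates nothing;
  in this way the empty set has an enumeration as well.  A number is represented by any
  sequence having it as its first entry.
\<close>

definition enumerates :: "baire \<Rightarrow> nat set \<Rightarrow> bool" where
  "enumerates p X \<longleftrightarrow> X = {n. Suc n \<in> range p}"

definition C_N :: problem where
  "C_N p = (if \<exists>A. A \<noteq> {} \<and> enumerates p (- A)
            then Some {q. \<exists>A. enumerates p (- A) \<and> q 0 \<in> A} else None)"

subsection \<open>Indivisibility of the rationals\<close>

definition iso_rat :: "nat set \<Rightarrow> (nat \<times> nat) set \<Rightarrow> bool" where
  "iso_rat D R \<longleftrightarrow>
     (\<exists>f :: nat \<Rightarrow> rat. bij_betw f D UNIV \<and> (\<forall>x\<in>D. \<forall>y\<in>D. (x, y) \<in> R \<longleftrightarrow> f x < f y))"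

text \<open>The strict order of a presentation; its domain may be any subset of the natural numbers.\<close>

definition presentation_rat :: "nat set \<Rightarrow> (nat \<times> nat) set \<Rightarrow> bool" where
  "presentation_rat D R \<longleftrightarrow> R \<subseteq> D \<times> D \<and> iso_rat D R"

definition char_fun :: "nat set \<Rightarrow> baire" where
  "char_fun X n = of_bool (n \<in> X)"

text \<open>
  The code of the triple consisting of the presentation \<open>(D, R)\<close>, the colouring \<open>c\<close> and the
  number \<open>k\<close>.  Only the values of \<open>c\<close> on \<open>D\<close> matter, those outside \<open>D\<close> being arbitrary.
\<close>

definition triple_code :: "nat set \<Rightarrow> (nat \<times> nat) set \<Rightarrow> baire \<Rightarrow> nat \<Rightarrow> baire" where
  "triple_code D R c k =
     case_nat k ((char_fun D \<oplus>\<^sub>B char_fun (prod_encode ` R)) \<oplus>\<^sub>B c)"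

definition ind_rat_instance :: "nat set \<Rightarrow> (nat \<times> nat) set \<Rightarrow> baire \<Rightarrow> nat \<Rightarrow> bool" where
  "ind_rat_instance D R c k \<longleftrightarrow> presentation_rat D R \<and> c ` D \<subseteq> {..<k}"

definition ind_rat_solution :: "nat set \<Rightarrow> (nat \<times> nat) set \<Rightarrow> baire \<Rightarrow> nat set \<Rightarrow> bool" where
  "ind_rat_solution D R c B \<longleftrightarrow>
     B \<subseteq> D \<and> (\<exists>i. \<forall>x\<in>B. c x = i) \<and> iso_rat B (R \<inter> B \<times> B)"

text \<open>A code determines the triple, so the quantifiers below range over at most one triple.\<close>

lemma triple_code_inject:
  "triple_code D R c k = triple_code D' R' c' k' \<longleftrightarrow> D = D' \<and> R = R' \<and> c = c' \<and> k = k'"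
proof
  assume eq: "triple_code D R c k = triple_code D' R' c' k'"
  have join: "p = p' \<and> q = q'" if "p \<oplus>\<^sub>B q = p' \<oplus>\<^sub>B q'" for p q p' q' :: baire
  proof -
    have "p n = p' n" for n using fun_cong[OF that, of "2 * n"] by (simp add: join_def)
    moreover have "q n = q' n" for n using fun_cong[OF that, of "2 * n + 1"] by (simp add: join_def)
    ultimately show ?thesis by auto
  qed
  have char: "X = Y" if "char_fun X = char_fun Y" for X Y
    using fun_cong[OF that] by (auto simp: char_fun_def of_bool_eq_iff)
  have k: "k = k'" using fun_cong[OF eq, of 0] by (simp add: triple_code_def)
  have "(char_fun D \<oplus>\<^sub>B char_fun (prod_encode ` R)) \<oplus>\<^sub>B c =
        (char_fun D' \<oplus>\<^sub>B char_fun (prod_encode ` R')) \<oplus>\<^sub>B c'"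
  proof
    fix n show "((char_fun D \<oplus>\<^sub>B char_fun (prod_encode ` R)) \<oplus>\<^sub>B c) n =
        ((char_fun D' \<oplus>\<^sub>B char_fun (prod_encode ` R')) \<oplus>\<^sub>B c') n"
      using fun_cong[OF eq, of "Suc n"] by (simp add: triple_code_def)
  qed
  note j = join[OF this]
  note c = j[THEN conjunct2] and j' = join[OF j[THEN conjunct1]]
  have "D = D'" by (rule char[OF j'[THEN conjunct1]])
  moreover have "R = R'"
    using char[OF j'[THEN conjunct2]] by (simp only: inj_image_eq_iff[OF inj_prod_encode])
  ultimately show "D = D' \<and> R = R' \<and> c = c' \<and> k = k'" using k c by simp
qed simp

definition Ind_Q :: problem where
  "Ind_Q p = (if \<exists>D R c k. p = triple_code D R c k \<and> ind_rat_instance D R c k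
     then Some {char_fun B | B. \<exists>D R c k. p = triple_code D R c k \<and> ind_rat_solution D R c B}
     else None)"

end

theory Submission
  imports Defs "HOL-Library.Countable_Set"
begin

text \<open>
  Suppose that a reduction is given, and consider for an interval of the presentation computed
  from an instance \<open>p\<close> the set of colours having a monochromatic copy of the rationals there.
  By induction on a finite set \<open>S\<close> of colours, every finite prefix and every interval admit an
  extension of the prefix after which the set of such colours is never contained in \<open>S\<close>.  For
  the step from \<open>S\<close> to \<open>S \<union> {i}\<close>, let colour \<open>i\<close> have a copy \<open>C\<close> in the interval; the backward
  functional computes a number \<open>a\<close> from a finite part \<open>F\<close> of \<open>C\<close>, and we enumerate \<open>a\<close> into the
  complement.  From then on \<open>F\<close> cannot be extended to a solution, so in one of the finitely many
  intervals between points of \<open>F\<close> there is no copy of colour \<open>i\<close>.  Which one it is may depend on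
  the rest of the instance, but the induction hypothesis for \<open>S\<close> can be applied to all of them,
  and then the interval without colour \<open>i\<close> yields a colour outside \<open>S \<union> {i}\<close>.  When \<open>S\<close> contains
  all colours, whose number is fixed by a finite prefix, this is a contradiction.
\<close>

section \<open>Dense linear orders without endpoints\<close>

text \<open>The relation is not confined to \<open>A\<close>, so one fixed \<open>R\<close> serves
  for all suborders, and passing to a subset needs no restriction of \<open>R\<close>.\<close>

definition dlo :: "'a rel \<Rightarrow> 'a set \<Rightarrow> bool" where
  "dlo R A \<longleftrightarrow> irrefl_on A R \<and> trans_on A R \<and> total_on A R \<and> A \<noteq> {} \<and>
     (\<forall>x\<in>A. \<forall>y\<in>A. (x, y) \<in> R \<longrightarrow> (\<exists>z\<in>A. (x, z) \<in> R \<and> (z, y) \<in> R)) \<and>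
     (\<forall>x\<in>A. \<exists>z\<in>A. (x, z) \<in> R) \<and> (\<forall>x\<in>A. \<exists>z\<in>A. (z, x) \<in> R)"

text \<open>Empty \<open>L\<close> or \<open>U\<close> are allowed, so rays and the whole of
  \<open>A\<close> are covered along with the intervals between two points.\<close>

definition gap :: "'a rel \<Rightarrow> 'a set \<Rightarrow> 'a set \<Rightarrow> 'a set \<Rightarrow> 'a set" where
  "gap R A L U = {z\<in>A. (\<forall>l\<in>L. (l, z) \<in> R) \<and> (\<forall>u\<in>U. (z, u) \<in> R)}"

lemma dloI:
  assumes "irrefl_on A R" "trans_on A R" "total_on A R" "A \<noteq> {}"
    and "\<And>x y. x \<in> A \<Longrightarrow> y \<in> A \<Longrightarrow> (x, y) \<in> R \<Longrightarrow> \<exists>z\<in>A. (x, z) \<in> R \<and> (z, y) \<in> R"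
    and "\<And>x. x \<in> A \<Longrightarrow> \<exists>z\<in>A. (x, z) \<in> R" "\<And>x. x \<in> A \<Longrightarrow> \<exists>z\<in>A. (z, x) \<in> R"
  shows "dlo R A"
  using assms unfolding dlo_def by blast

lemma
  assumes "dlo R A"
  shows dlo_irrefl: "x \<in> A \<Longrightarrow> (x, x) \<notin> R"
    and dlo_trans: "(x, y) \<in> R \<Longrightarrow> (y, z) \<in> R \<Longrightarrow> x \<in> A \<Longrightarrow> y \<in> A \<Longrightarrow> z \<in> A \<Longrightarrow> (x, z) \<in> R"
    and dlo_total: "x \<in> A \<Longrightarrow> y \<in> A \<Longrightarrow> x \<noteq> y \<Longrightarrow> (x, y) \<in> R \<or> (y, x) \<in> R"
    and dlo_nonempty: "A \<noteq> {}"
    and dlo_dense: "(x, y) \<in> R \<Longrightarrow> x \<in> A \<Longrightarrow> y \<in> A \<Longrightarrow> \<exists>z\<in>A. (x, z) \<in> R \<and> (z, y) \<in> R"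
    and dlo_gt_ex: "x \<in> A \<Longrightarrow> \<exists>z\<in>A. (x, z) \<in> R"
    and dlo_lt_ex: "x \<in> A \<Longrightarrow> \<exists>z\<in>A. (z, x) \<in> R"
  using assms unfolding dlo_def irrefl_on_def trans_on_def total_on_def by blast+

lemma dlo_subset_linear:
  assumes "dlo R A" "B \<subseteq> A"
  shows "irrefl_on B R" "trans_on B R" "total_on B R"
  using assms unfolding dlo_def
  by (auto intro: irrefl_on_subset trans_on_subset total_on_subset)

lemma dlo_converse: "dlo R A \<Longrightarrow> dlo (R\<inverse>) A"
  unfolding dlo_def converse_iff irrefl_on_converse trans_on_converse total_on_converse by meson

lemma finite_has_greatest:
  assumes "dlo R A" "finite L" "L \<noteq> {}" "L \<subseteq> A"
  shows "\<exists>m\<in>L. \<forall>l\<in>L. l = m \<or> (l, m) \<in> R"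
  using assms(2-4)
proof (induction rule: finite_ne_induct)
  case (insert x L)
  then obtain m where m: "m \<in> L" "\<forall>l\<in>L. l = m \<or> (l, m) \<in> R" by auto
  show ?case
  proof (cases "(x, m) \<in> R")
    case False
    then have xm: "(m, x) \<in> R" using dlo_total[OF assms(1), of x m] insert m by auto
    have "(l, x) \<in> R" if "l \<in> L" for l
    proof (cases "l = m")
      case False
      then have "(l, m) \<in> R" using m that by auto
      then show ?thesis using dlo_trans[OF assms(1), of l m x] xm m that insert.prems by auto
    qed (use xm in simp)
    then show ?thesis by auto
  qed (use m in auto)
qed simp

text \<open>Only the greatest element of \<open>L\<close> and the least element of \<open>U\<close>
  matter. Density applies if both exist, and the absence of endpoints if one of the sets is
  empty.\<close>

lemma gap_nonempty:
  assumes "dlo R A" "finite L" "finite U" "L \<subseteq> A" "U \<subseteq> A" "\<forall>l\<in>L. \<forall>u\<in>U. (l, u) \<in> R"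
  shows "gap R A L U \<noteq> {}"
proof -
  have lo: "L = {} \<or> (\<exists>m\<in>L. \<forall>l\<in>L. l = m \<or> (l, m) \<in> R)"
    using finite_has_greatest[OF assms(1,2)] assms(4) by blast
  have up: "U = {} \<or> (\<exists>m\<in>U. \<forall>u\<in>U. u = m \<or> (m, u) \<in> R)"
    using finite_has_greatest[OF dlo_converse[OF assms(1)] assms(3)] assms(5) by auto
  have l: "\<forall>l\<in>L. (l, z) \<in> R" if "m \<in> L" "\<forall>l\<in>L. l = m \<or> (l, m) \<in> R" "(m, z) \<in> R" "z \<in> A" for m z
    using that dlo_trans[OF assms(1)] assms(4) by (metis subsetD)
  have u: "\<forall>u\<in>U. (z, u) \<in> R" if "m \<in> U" "\<forall>u\<in>U. u = m \<or> (m, u) \<in> R" "(z, m) \<in> R" "z \<in> A" for m z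
    using that dlo_trans[OF assms(1)] assms(5) by (metis subsetD)
  consider "L = {}" "U = {}"
    | m where "L = {}" "m \<in> U" "\<forall>u\<in>U. u = m \<or> (m, u) \<in> R"
    | m where "U = {}" "m \<in> L" "\<forall>l\<in>L. l = m \<or> (l, m) \<in> R"
    | m n where "m \<in> L" "\<forall>l\<in>L. l = m \<or> (l, m) \<in> R" "n \<in> U" "\<forall>u\<in>U. u = n \<or> (n, u) \<in> R"
    using lo up by blast
  then have "\<exists>z\<in>A. (\<forall>l\<in>L. (l, z) \<in> R) \<and> (\<forall>u\<in>U. (z, u) \<in> R)"
  proof cases
    case 1 then show ?thesis using dlo_nonempty[OF assms(1)] by auto
  next
    case (2 m)
    then obtain z where "z \<in> A" "(z, m) \<in> R" using dlo_lt_ex[OF assms(1)] assms(5) by blast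
    then show ?thesis using 2 u[OF 2(2,3)] by blast
  next
    case (3 m)
    then obtain z where "z \<in> A" "(m, z) \<in> R" using dlo_gt_ex[OF assms(1)] assms(4) by blast
    then show ?thesis using 3 l[OF 3(2,3)] by blast
  next
    case (4 m n)
    then obtain z where "z \<in> A" "(m, z) \<in> R" "(z, n) \<in> R"
      using dlo_dense[OF assms(1), of m n] assms(4-6) by (meson subsetD)
    then show ?thesis using l[OF 4(1,2)] u[OF 4(3,4)] by blast
  qed
  then show ?thesis unfolding gap_def by blast
qed

text \<open>A witness for density or for the absence of endpoints is a point of the smaller gap that
  arises by adding \<open>x\<close> to \<open>L\<close> or the upper point to
  \<open>U\<close>.\<close>

lemma dlo_gap:
  assumes "dlo R A" "finite L" "finite U" "L \<subseteq> A" "U \<subseteq> A" "\<forall>l\<in>L. \<forall>u\<in>U. (l, u) \<in> R"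
  shows "dlo R (gap R A L U)"
proof -
  have sub: "gap R A L U \<subseteq> A" unfolding gap_def by blast
  show ?thesis
  proof (rule dloI)
    fix x y assume xy: "x \<in> gap R A L U" "y \<in> gap R A L U" "(x, y) \<in> R"
    then have "gap R A (insert x L) (insert y U) \<noteq> {}"
      using assms by (intro gap_nonempty) (auto simp: gap_def)
    then show "\<exists>z\<in>gap R A L U. (x, z) \<in> R \<and> (z, y) \<in> R" unfolding gap_def by blast
  next
    fix x assume x: "x \<in> gap R A L U"
    then have "gap R A (insert x L) U \<noteq> {}"
      using assms by (intro gap_nonempty) (auto simp: gap_def)
    then show "\<exists>z\<in>gap R A L U. (x, z) \<in> R" unfolding gap_def by blast
    have "gap R A L (insert x U) \<noteq> {}"
      using assms x by (intro gap_nonempty) (auto simp: gap_def)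
    then show "\<exists>z\<in>gap R A L U. (z, x) \<in> R" unfolding gap_def by blast
  qed (fact gap_nonempty[OF assms] dlo_subset_linear[OF assms(1) sub])+
qed

text \<open>Between any two points lie two distinct points, at most one of which is
  \<open>a\<close>.\<close>

lemma dlo_remove1:
  assumes "dlo R A"
  shows "dlo R (A - {a})"
proof -
  have dense: "\<exists>z\<in>A - {a}. (x, z) \<in> R \<and> (z, y) \<in> R" if xy: "x \<in> A" "y \<in> A" "(x, y) \<in> R" for x y
  proof -
    obtain z where z: "z \<in> A" "(x, z) \<in> R" "(z, y) \<in> R" using dlo_dense[OF assms] xy by blast
    then obtain w where w: "w \<in> A" "(x, w) \<in> R" "(w, z) \<in> R"
      using dlo_dense[OF assms, of x z] xy by blast
    have "(w, y) \<in> R" "w \<noteq> z"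
      using dlo_trans[OF assms, of w z y] dlo_irrefl[OF assms, of z] xy z w by blast+
    then show ?thesis using z w by (cases "z = a") auto
  qed
  have gt: "\<exists>z\<in>A - {a}. (x, z) \<in> R" and lt: "\<exists>z\<in>A - {a}. (z, x) \<in> R" if "x \<in> A" for x
    using dense dlo_gt_ex[OF assms that] dlo_lt_ex[OF assms that] that by meson+
  show ?thesis
  proof (rule dloI)
    show "A - {a} \<noteq> {}" using gt dlo_nonempty[OF assms] by blast
    show "irrefl_on (A - {a}) R" "trans_on (A - {a}) R" "total_on (A - {a}) R"
      using dlo_subset_linear[OF assms, of "A - {a}"] by blast+
  qed (use dense gt lt in blast)+
qed

text \<open>This later clears a copy of the rationals of all numbers below a bound, which gives
  control over a finite part of its characteristic function.\<close>

lemma dlo_remove: "finite X \<Longrightarrow> dlo R A \<Longrightarrow> dlo R (A - X)"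
proof (induction rule: finite_induct)
  case (insert a X)
  then show ?case using dlo_remove1[of R "A - X" a] by (metis Diff_insert)
qed simp

text \<open>Indivisibility for finitely many colours: either colour \<open>i\<close> is absent
  between some two points, and the induction hypothesis applies there, or the points of colour
  \<open>i\<close> are dense in \<open>A\<close> and form a copy themselves.\<close>

lemma dlo_monochromatic:
  assumes "finite K" "dlo R A" "c ` A \<subseteq> K"
  shows "\<exists>i\<in>K. \<exists>C\<subseteq>A. dlo R C \<and> (\<forall>x\<in>C. c x = i)"
  using assms
proof (induction arbitrary: A rule: finite_induct)
  case empty
  then show ?case using dlo_nonempty[OF empty.prems(1)] by simp
next
  case (insert i K)
  note A = \<open>dlo R A\<close>
  show ?case
  proof (cases "\<exists>x\<in>A. \<exists>y\<in>A. (x, y) \<in> R \<and> i \<notin> c ` gap R A {x} {y}")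
    case True
    then obtain x y where xy: "x \<in> A" "y \<in> A" "(x, y) \<in> R" "i \<notin> c ` gap R A {x} {y}" by blast
    have sub: "gap R A {x} {y} \<subseteq> A" unfolding gap_def by blast
    have "dlo R (gap R A {x} {y})" using xy A by (intro dlo_gap) auto
    moreover have "c ` gap R A {x} {y} \<subseteq> K" using insert.prems(2) xy(4) image_mono[OF sub, of c] by blast
    ultimately obtain j C where "j \<in> K" "C \<subseteq> gap R A {x} {y}" "dlo R C" "\<forall>x\<in>C. c x = j"
      using insert.IH[of "gap R A {x} {y}"] by blast
    moreover from this sub have "C \<subseteq> A" by (meson subset_trans)
    ultimately show ?thesis by blast
  next
    case False
    define C where "C = {x\<in>A. c x = i}"
    have dense: "\<exists>z\<in>C. (x, z) \<in> R \<and> (z, y) \<in> R" if "x \<in> A" "y \<in> A" "(x, y) \<in> R" for x y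
    proof -
      have "i \<in> c ` gap R A {x} {y}" using False that by blast
      then show ?thesis unfolding C_def gap_def by auto
    qed
    have gt: "\<exists>z\<in>C. (x, z) \<in> R" and lt: "\<exists>z\<in>C. (z, x) \<in> R" if "x \<in> A" for x
      using dense dlo_gt_ex[OF A that] dlo_lt_ex[OF A that] that by meson+
    have "C \<subseteq> A" unfolding C_def by blast
    have "dlo R C"
    proof (rule dloI)
      show "C \<noteq> {}" using gt dlo_nonempty[OF A] by blast
      show "irrefl_on C R" "trans_on C R" "total_on C R"
        using dlo_subset_linear[OF A \<open>C \<subseteq> A\<close>] by blast+
    qed (use dense gt lt \<open>C \<subseteq> A\<close> in blast)+
    moreover have "\<forall>x\<in>C. c x = i" unfolding C_def by simp
    ultimately show ?thesis using \<open>C \<subseteq> A\<close> by blast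
  qed
qed

text \<open>
  The sets \<open>G\<close> range over the initial segments of \<open>F\<close>, so that the sets \<open>C G\<close> fill
  the intervals into which \<open>F\<close> divides the order.
\<close>

lemma dlo_glue:
  assumes A: "dlo R A" and F: "F \<subseteq> A"
    and C: "\<And>G. G \<subseteq> F \<Longrightarrow> \<forall>x\<in>G. \<forall>y\<in>F - G. (x, y) \<in> R \<Longrightarrow> dlo R (C G) \<and> C G \<subseteq> gap R A G (F - G)"
  shows "dlo R (F \<union> (\<Union>G\<in>{G. G \<subseteq> F \<and> (\<forall>x\<in>G. \<forall>y\<in>F - G. (x, y) \<in> R)}. C G))" (is "dlo R ?B")
proof -
  define I where "I = {G. G \<subseteq> F \<and> (\<forall>x\<in>G. \<forall>y\<in>F - G. (x, y) \<in> R)}"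
  have B: "?B = F \<union> (\<Union>G\<in>I. C G)" unfolding I_def ..
  have CI: "dlo R (C G)" "C G \<subseteq> A" if "G \<in> I" for G
    using C that unfolding I_def gap_def by blast+
  have lo: "(g, z) \<in> R" if "G \<in> I" "z \<in> C G" "g \<in> G" for g G z
    using C that unfolding I_def gap_def by blast
  have up: "(z, g) \<in> R" if "G \<in> I" "z \<in> C G" "g \<in> F" "g \<notin> G" for g G z
    using C that unfolding I_def gap_def by blast
  note tr = dlo_trans[OF A] and ir = dlo_irrefl[OF A] and tot = dlo_total[OF A]
  \<comment> \<open>For \<open>x\<close> in \<open>F\<close>, the segments ending just after and
    just before \<open>x\<close> have pieces lying directly above and below \<open>x\<close>. They
    supply the neighbours of \<open>x\<close> in the union.\<close>
  have upto: "{f\<in>F. f = x \<or> (f, x) \<in> R} \<in> I" if "x \<in> F" for x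
  proof -
    have "(g, h) \<in> R" if "g \<in> F" "g = x \<or> (g, x) \<in> R" "h \<in> F" "\<not> (h = x \<or> (h, x) \<in> R)" for g h
      using tot[of x h] tr[of g x h] that F \<open>x \<in> F\<close> by blast
    then show ?thesis unfolding I_def by blast
  qed
  have below: "{f\<in>F. (f, x) \<in> R} \<in> I" if "x \<in> F" for x
  proof -
    have "(g, h) \<in> R" if "g \<in> F" "(g, x) \<in> R" "h \<in> F" "(h, x) \<notin> R" for g h
      using tot[of x h] tr[of g x h] that F \<open>x \<in> F\<close> by blast
    then show ?thesis unfolding I_def by blast
  qed
  have sub: "?B \<subseteq> A" using F CI unfolding B by blast
  have gt: "\<exists>z\<in>?B. (x, z) \<in> R" if "x \<in> ?B" for x
  proof (cases "x \<in> F")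
    case True
    then obtain z where "z \<in> C {f\<in>F. f = x \<or> (f, x) \<in> R}" using CI(1)[OF upto] dlo_nonempty by blast
    then show ?thesis using lo[OF upto[OF True]] upto[OF True] True unfolding B by blast
  next
    case False
    then show ?thesis using that CI(1) dlo_gt_ex unfolding B by (metis UN_iff Un_iff)
  qed
  have lt: "\<exists>z\<in>?B. (z, x) \<in> R" if "x \<in> ?B" for x
  proof (cases "x \<in> F")
    case True
    then obtain z where "z \<in> C {f\<in>F. (f, x) \<in> R}" using CI(1)[OF below] dlo_nonempty by blast
    then show ?thesis using up[OF below[OF True], of z x] below[OF True] True ir F unfolding B by blast
  next
    case False
    then show ?thesis using that CI(1) dlo_lt_ex unfolding B by (metis UN_iff Un_iff)
  qed
  have dense: "\<exists>z\<in>?B. (x, z) \<in> R \<and> (z, y) \<in> R" if xy: "x \<in> ?B" "y \<in> ?B" "(x, y) \<in> R" for x y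
  proof -
    have xA: "x \<in> A" and yA: "y \<in> A" using xy sub by (auto dest: subsetD)
    have asym: "(y, x) \<notin> R" "x \<noteq> y" using tr[of x y x] ir[of x] xy(3) xA yA by blast+
    consider "x \<in> F" "y \<in> F" | H where "x \<in> F" "H \<in> I" "y \<in> C H" | G where "G \<in> I" "x \<in> C G" "y \<in> F"
      | G H where "G \<in> I" "x \<in> C G" "H \<in> I" "y \<in> C H"
      using xy unfolding B by blast
    then show ?thesis
    proof cases
      case 1
      let ?G = "{f\<in>F. f = x \<or> (f, x) \<in> R}"
      obtain z where "z \<in> C ?G" using CI(1)[OF upto] dlo_nonempty 1 by blast
      moreover have "y \<notin> ?G" using asym by blast
      ultimately have "(x, z) \<in> R" "(z, y) \<in> R"
        using lo[OF upto[OF 1(1)], of z x] up[OF upto[OF 1(1)], of z y] 1 by blast+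
      then show ?thesis using upto[OF 1(1)] \<open>z \<in> C ?G\<close> unfolding B by blast
    next
      case 2
      then obtain z where "z \<in> C H" "(z, y) \<in> R" using CI(1) dlo_lt_ex by metis
      moreover have "x \<in> H" using up 2 asym by blast
      ultimately show ?thesis using lo 2 unfolding B by blast
    next
      case 3
      then obtain z where "z \<in> C G" "(x, z) \<in> R" using CI(1) dlo_gt_ex by metis
      moreover have "y \<notin> G" using lo 3 asym by blast
      ultimately show ?thesis using up 3 unfolding B by blast
    next
      case 4
      show ?thesis
      proof (cases "G = H")
        case True
        then show ?thesis using dlo_dense[OF CI(1)[OF 4(1)], of x y] 4 xy(3) unfolding B by blast
      next
        case False
        \<comment> \<open>Initial segments are nested, and since \<open>x\<close> precedes
          \<open>y\<close> the segment of \<open>x\<close> is the smaller one. A point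
          \<open>f\<close> of \<open>H - G\<close> then lies above all of \<open>C G\<close> and
          below all of \<open>C H\<close>.\<close>
        have "G \<subseteq> H"
        proof
          fix g assume g: "g \<in> G"
          then have "(g, x) \<in> R" "g \<in> F" using 4 lo[of G x g] unfolding I_def by blast+
          then have "(g, y) \<in> R" "(y, g) \<notin> R"
            using tr[of g x y] tr[of y g x] asym xy(3) xA yA F by blast+
          then show "g \<in> H" using up[OF 4(3), of y g] 4(4) \<open>g \<in> F\<close> by blast
        qed
        then obtain f where f: "f \<in> H" "f \<notin> G" "f \<in> F" using False 4(3) unfolding I_def by blast
        obtain z where z: "z \<in> C G" "(x, z) \<in> R" using CI(1) dlo_gt_ex 4 by metis
        have "(z, f) \<in> R" "(f, y) \<in> R" using up[OF 4(1), of z f] lo[OF 4(3), of y f] 4(4) f z by blast+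
        then have "(z, y) \<in> R" using tr[of z f y] z(1) f(3) F yA CI(2)[OF 4(1)] by blast
        then show ?thesis using z 4 unfolding B by blast
      qed
    qed
  qed
  have "{} \<in> I" unfolding I_def by simp
  then have "?B \<noteq> {}" using dlo_nonempty[OF CI(1)] unfolding B by blast
  then show ?thesis using dlo_subset_linear[OF A sub] gt lt dense by (intro dloI)
qed

section \<open>Cantor's isomorphism theorem\<close>

text \<open>The equivalence of the two equalities makes \<open>P\<close> single-valued and injective
  at once. The definition is symmetric in both orders, as the back-and-forth argument
  requires.\<close>

definition partial_iso :: "'a rel \<Rightarrow> 'a set \<Rightarrow> 'b rel \<Rightarrow> 'b set \<Rightarrow> ('a \<times> 'b) set \<Rightarrow> bool" where
  "partial_iso R A S B P \<longleftrightarrow> P \<subseteq> A \<times> B \<and>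
     (\<forall>x y x' y'. (x, y) \<in> P \<longrightarrow> (x', y') \<in> P \<longrightarrow>
        ((x, x') \<in> R \<longleftrightarrow> (y, y') \<in> S) \<and> (x = x' \<longleftrightarrow> y = y'))"

lemma
  assumes "partial_iso R A S B P"
  shows partial_iso_subset: "P \<subseteq> A \<times> B"
    and partial_iso_rel: "(x, y) \<in> P \<Longrightarrow> (x', y') \<in> P \<Longrightarrow> (x, x') \<in> R \<longleftrightarrow> (y, y') \<in> S"
    and partial_iso_eq: "(x, y) \<in> P \<Longrightarrow> (x', y') \<in> P \<Longrightarrow> x = x' \<longleftrightarrow> y = y'"
  using assms unfolding partial_iso_def by simp_all

lemma partial_iso_converse:
  assumes "partial_iso R A S B P" shows "partial_iso S B R A (P\<inverse>)"
  unfolding partial_iso_def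
proof (intro conjI allI impI)
  show "P\<inverse> \<subseteq> B \<times> A" using partial_iso_subset[OF assms] by blast
  fix y x y' x' assume "(y, x) \<in> P\<inverse>" "(y', x') \<in> P\<inverse>"
  then have P: "(x, y) \<in> P" "(x', y') \<in> P" by simp_all
  show "(y, y') \<in> S \<longleftrightarrow> (x, x') \<in> R" "y = y' \<longleftrightarrow> x = x'"
    using partial_iso_rel[OF assms P] partial_iso_eq[OF assms P] by simp_all
qed

text \<open>The partners of the points below \<open>x\<close> lie below those of the points above
  \<open>x\<close>. As both sets are finite, their gap in \<open>B\<close> is nonempty, and any
  point of it can serve as \<open>y\<close>.\<close>

lemma partial_iso_extend:
  assumes A: "dlo R A" and B: "dlo S B" and P: "partial_iso R A S B P" "finite P" and "x \<in> A"
  shows "\<exists>y. partial_iso R A S B (insert (x, y) P)"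
proof (cases "x \<in> Domain P")
  case True
  then show ?thesis using P by (metis DomainE insert_absorb)
next
  case False
  define L U where "L = P `` {a. (a, x) \<in> R}" and "U = P `` {a. (x, a) \<in> R}"
  have PAB: "a \<in> A" "b \<in> B" if "(a, b) \<in> P" for a b
    using partial_iso_subset[OF P(1)] that by auto
  have "finite L" "finite U" using P(2) unfolding L_def U_def by (auto intro: finite_Image)
  moreover have "L \<subseteq> B" "U \<subseteq> B" using PAB unfolding L_def U_def by blast+
  moreover have "(l, u) \<in> S" if lu: "l \<in> L" "u \<in> U" for l u
  proof -
    obtain a a' where a: "(a, l) \<in> P" "(a, x) \<in> R" "(a', u) \<in> P" "(x, a') \<in> R"
      using lu unfolding L_def U_def by blast
    then have "(a, a') \<in> R" using dlo_trans[OF A, of a x a'] PAB \<open>x \<in> A\<close> by blast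
    then show ?thesis using partial_iso_rel[OF P(1) a(1,3)] by simp
  qed
  ultimately have "gap S B L U \<noteq> {}" by (intro gap_nonempty[OF B]) auto
  then obtain y where y: "y \<in> B" "\<forall>l\<in>L. (l, y) \<in> S" "\<forall>u\<in>U. (y, u) \<in> S" unfolding gap_def by blast
  have new: "((a, x) \<in> R \<longleftrightarrow> (b, y) \<in> S) \<and> ((x, a) \<in> R \<longleftrightarrow> (y, b) \<in> S) \<and> a \<noteq> x \<and> b \<noteq> y"
    if ab: "(a, b) \<in> P" for a b
  proof -
    have "a \<noteq> x" using False ab by blast
    have asym: "\<not> ((a, x) \<in> R \<and> (x, a) \<in> R)" "\<not> ((b, y) \<in> S \<and> (y, b) \<in> S)"
      "(b, y) \<in> S \<or> (y, b) \<in> S \<Longrightarrow> b \<noteq> y"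
      using dlo_trans[OF A, of x a x] dlo_trans[OF B, of y b y] dlo_irrefl[OF A, of x]
        dlo_irrefl[OF B, of y] PAB[OF ab] y(1) \<open>x \<in> A\<close> by blast+
    have "(a, x) \<in> R \<longrightarrow> (b, y) \<in> S" "(x, a) \<in> R \<longrightarrow> (y, b) \<in> S"
      using y(2,3) ab unfolding L_def U_def by blast+
    moreover have "(a, x) \<in> R \<or> (x, a) \<in> R"
      using dlo_total[OF A, of a x] \<open>a \<noteq> x\<close> PAB[OF ab] \<open>x \<in> A\<close> by blast
    ultimately show ?thesis using asym \<open>a \<noteq> x\<close> by blast
  qed
  have irr: "(x, x) \<notin> R" "(y, y) \<notin> S"
    using dlo_irrefl[OF A \<open>x \<in> A\<close>] dlo_irrefl[OF B y(1)] by simp_all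
  have "partial_iso R A S B (insert (x, y) P)"
    unfolding partial_iso_def
  proof (intro conjI allI impI)
    show "insert (x, y) P \<subseteq> A \<times> B" using partial_iso_subset[OF P(1)] y(1) \<open>x \<in> A\<close> by blast
    fix a b a' b' assume "(a, b) \<in> insert (x, y) P" "(a', b') \<in> insert (x, y) P"
    then consider "(a, b) \<in> P" "(a', b') \<in> P" | "a = x" "b = y" "(a', b') \<in> P"
      | "(a, b) \<in> P" "a' = x" "b' = y" | "a = x" "b = y" "a' = x" "b' = y"
      by blast
    then have "((a, a') \<in> R \<longleftrightarrow> (b, b') \<in> S) \<and> (a = a' \<longleftrightarrow> b = b')"
    proof cases
      case 1
      then show ?thesis using partial_iso_rel[OF P(1) 1] partial_iso_eq[OF P(1) 1] by simp
    next
      case 2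
      then show ?thesis using new[of a' b'] by metis
    next
      case 3
      then show ?thesis using new[of a b] by metis
    qed (use irr in simp)
    then show "(a, a') \<in> R \<longleftrightarrow> (b, b') \<in> S" "a = a' \<longleftrightarrow> b = b'" by simp_all
  qed
  then show ?thesis ..
qed

text \<open>The back step is the forth step for the converse relation.\<close>

lemma partial_iso_extend_both:
  assumes "dlo R A" "dlo S B" "partial_iso R A S B P" "finite P" "a \<in> A" "b \<in> B"
  shows "\<exists>Q. partial_iso R A S B Q \<and> finite Q \<and> P \<subseteq> Q \<and> a \<in> Domain Q \<and> b \<in> Range Q"
proof -
  obtain y where "partial_iso R A S B (insert (a, y) P)"
    using partial_iso_extend[OF assms(1-5)] by blast
  then have "partial_iso S B R A ((insert (a, y) P)\<inverse>)" by (rule partial_iso_converse)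
  moreover have "finite ((insert (a, y) P)\<inverse>)" using assms(4) by simp
  ultimately obtain x where "partial_iso S B R A (insert (b, x) ((insert (a, y) P)\<inverse>))"
    using partial_iso_extend[OF assms(2,1) _ _ assms(6)] by blast
  then have "partial_iso R A S B ((insert (b, x) ((insert (a, y) P)\<inverse>))\<inverse>)"
    by (rule partial_iso_converse)
  then show ?thesis using assms(4)
    by (intro exI[of _ "(insert (b, x) ((insert (a, y) P)\<inverse>))\<inverse>"]) auto
qed

text \<open>Back and forth: stage \<open>n\<close> adds the \<open>n\<close>-th elements of both
  enumerations to a finite partial isomorphism, and the union of this chain is the graph of
  \<open>f\<close>.\<close>

theorem cantor_isomorphism:
  assumes A: "dlo R A" "countable A" and B: "dlo S B" "countable B"
  shows "\<exists>f. bij_betw f A B \<and> (\<forall>x\<in>A. \<forall>y\<in>A. (x, y) \<in> R \<longleftrightarrow> (f x, f y) \<in> S)"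
proof -
  let ?a = "from_nat_into A" and ?b = "from_nat_into B"
  have ne: "A \<noteq> {}" "B \<noteq> {}" using A B dlo_nonempty by blast+
  have "\<exists>P. \<forall>n. (partial_iso R A S B (P n) \<and> finite (P n)) \<and>
      (P n \<subseteq> P (Suc n) \<and> ?a n \<in> Domain (P (Suc n)) \<and> ?b n \<in> Range (P (Suc n)))"
  proof (rule dependent_nat_choice)
    show "\<exists>P. partial_iso R A S B P \<and> finite P" by (rule exI[of _ "{}"]) (simp add: partial_iso_def)
  next
    fix P n assume "partial_iso R A S B P \<and> finite P"
    then show "\<exists>Q. (partial_iso R A S B Q \<and> finite Q) \<and> P \<subseteq> Q \<and> ?a n \<in> Domain Q \<and> ?b n \<in> Range Q"
      using partial_iso_extend_both[OF A(1) B(1), of P "?a n" "?b n"] from_nat_into ne by metis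
  qed
  then obtain P where P: "\<And>n. partial_iso R A S B (P n)" "\<And>n. P n \<subseteq> P (Suc n)"
    "\<And>n. ?a n \<in> Domain (P (Suc n))" "\<And>n. ?b n \<in> Range (P (Suc n))" by metis
  have mono: "P m \<subseteq> P n" if "m \<le> n" for m n using lift_Suc_mono_le[of P, OF P(2) that] .
  define Q where "Q = (\<Union>n. P n)"
  have iso: "((x, x') \<in> R \<longleftrightarrow> (y, y') \<in> S) \<and> (x = x' \<longleftrightarrow> y = y')"
    if xy: "(x, y) \<in> Q" "(x', y') \<in> Q" for x y x' y'
  proof -
    obtain m n where "(x, y) \<in> P m" "(x', y') \<in> P n" using xy unfolding Q_def by blast
    then have "(x, y) \<in> P (max m n)" "(x', y') \<in> P (max m n)"
      using mono[of m "max m n"] mono[of n "max m n"] by auto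
    then show ?thesis using partial_iso_rel[OF P(1)] partial_iso_eq[OF P(1)] by blast
  qed
  have QAB: "Q \<subseteq> A \<times> B" using partial_iso_subset[OF P(1)] unfolding Q_def by blast
  have dom: "\<exists>y. (x, y) \<in> Q" if x: "x \<in> A" for x
  proof -
    obtain n where "?a n = x" using from_nat_into_surj[OF A(2) x] by blast
    then show ?thesis using P(3)[of n] unfolding Q_def by blast
  qed
  have ran: "\<exists>x. (x, y) \<in> Q" if y: "y \<in> B" for y
  proof -
    obtain n where "?b n = y" using from_nat_into_surj[OF B(2) y] by blast
    then show ?thesis using P(4)[of n] unfolding Q_def by blast
  qed
  obtain f where f: "\<And>x. x \<in> A \<Longrightarrow> (x, f x) \<in> Q" using dom by metis
  have "f ` A = B"
  proof
    show "f ` A \<subseteq> B" using f QAB by blast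
    show "B \<subseteq> f ` A"
    proof
      fix y assume "y \<in> B"
      then obtain x where "(x, y) \<in> Q" using ran by metis
      then show "y \<in> f ` A" using f[of x] iso[of x y x "f x"] QAB by auto
    qed
  qed
  moreover have "inj_on f A" using f iso by (intro inj_onI) metis
  ultimately show ?thesis using f iso unfolding bij_betw_def by blast
qed

section \<open>Dense orders as copies of the rationals\<close>

lemma dlo_rat: "dlo {(x, y). x < y} (UNIV :: rat set)"
  by (rule dloI) (auto simp: irrefl_on_def trans_on_def total_on_def intro: dense lt_ex gt_ex)

text \<open>A set of natural numbers is countable, so Cantor's theorem applies. From here on
  \<open>dlo\<close> replaces the isomorphism with the rationals.\<close>

lemma dlo_imp_iso_rat:
  assumes "dlo R B" shows "iso_rat B (R \<inter> B \<times> B)"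
proof -
  have "\<exists>f. bij_betw f B (UNIV :: rat set) \<and> (\<forall>x\<in>B. \<forall>y\<in>B. (x, y) \<in> R \<longleftrightarrow> (f x, f y) \<in> {(x, y). x < y})"
    by (rule cantor_isomorphism[OF assms _ dlo_rat]) auto
  then show ?thesis unfolding iso_rat_def by auto
qed

lemma iso_rat_imp_dlo:
  assumes "iso_rat A R" shows "dlo R A"
proof -
  obtain f :: "nat \<Rightarrow> rat" where f: "bij_betw f A UNIV" "\<And>x y. x \<in> A \<Longrightarrow> y \<in> A \<Longrightarrow> (x, y) \<in> R \<longleftrightarrow> f x < f y"
    using assms unfolding iso_rat_def by blast
  have surj: "\<exists>z\<in>A. f z = q" for q using f(1) unfolding bij_betw_def by (metis UNIV_I image_iff)
  show ?thesis
  proof (rule dloI)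
    show "irrefl_on A R" "trans_on A R" using f(2) unfolding irrefl_on_def trans_on_def by force+
    show "total_on A R" using f unfolding total_on_def bij_betw_def inj_on_def by (meson linorder_neqE)
    show "A \<noteq> {}" using surj by blast
    fix x assume x: "x \<in> A"
    show "\<exists>z\<in>A. (x, z) \<in> R" using gt_ex[of "f x"] f(2) x surj by metis
    show "\<exists>z\<in>A. (z, x) \<in> R" using lt_ex[of "f x"] f(2) x surj by metis
    fix y assume "y \<in> A" "(x, y) \<in> R"
    then show "\<exists>z\<in>A. (x, z) \<in> R \<and> (z, y) \<in> R" using dense[of "f x" "f y"] f(2) x surj by metis
  qed
qed

section \<open>Continuity of Turing functionals\<close>

definition agree :: "nat \<Rightarrow> baire \<Rightarrow> baire \<Rightarrow> bool" where
  "agree N p q \<longleftrightarrow> (\<forall>n<N. p n = q n)"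

lemma agree_mono: "agree N p q \<Longrightarrow> M \<le> N \<Longrightarrow> agree M p q" by (auto simp: agree_def)

lemma agree_trans: "agree N p q \<Longrightarrow> agree N q r \<Longrightarrow> agree N p r" by (auto simp: agree_def)

text \<open>Entry \<open>n\<close> of a join is entry \<open>n div 2\<close> of a component.
  Agreement would even extend below \<open>2 * N\<close>, but the weaker form keeps a single
  bound.\<close>

lemma agree_join: "agree N p p' \<Longrightarrow> agree N q q' \<Longrightarrow> agree N (p \<oplus>\<^sub>B q) (p' \<oplus>\<^sub>B q')"
  by (auto simp: agree_def join_def)

lemma finite_common_bound:
  fixes P :: "'a \<Rightarrow> nat \<Rightarrow> bool"
  assumes "finite X" "\<And>x. x \<in> X \<Longrightarrow> \<exists>N. P x N" "\<And>x M N. P x M \<Longrightarrow> M \<le> N \<Longrightarrow> P x N"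
  shows "\<exists>N. \<forall>x\<in>X. P x N"
proof -
  obtain N where N: "\<And>x. x \<in> X \<Longrightarrow> P x (N x)" using assms(2) by metis
  have "P x (Max (N ` X))" if "x \<in> X" for x
    using assms(3)[OF N[OF that]] assms(1) that by simp
  then show ?thesis by blast
qed

text \<open>The use principle: a converging computation consults only finitely many oracle values.
  For \<open>Mu\<close>, the computations at all smaller arguments are finitely many and share a
  common bound.\<close>

lemma eval_use:
  "eval p e xs y \<Longrightarrow> \<exists>N. \<forall>q. agree N p q \<longrightarrow> eval q e xs y"
proof (induction rule: eval.induct)
  case (eval_Query x)
  have "eval q Query [x] (p x)" if "agree (Suc x) p q" for q
    using eval.eval_Query[of q x] that by (simp add: agree_def)
  then show ?case by blast
next
  case (eval_Comp xs gs ys f z)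
  then have len: "length gs = length ys"
    and gs: "\<And>i. i < length ys \<Longrightarrow> \<exists>N. \<forall>q. agree N p q \<longrightarrow> eval q (gs ! i) xs (ys ! i)"
    by (auto simp: list_all2_conv_all_nth)
  have "\<exists>N. \<forall>i\<in>{..<length ys}. \<forall>q. agree N p q \<longrightarrow> eval q (gs ! i) xs (ys ! i)"
    by (rule finite_common_bound) (auto simp: gs intro: agree_mono)
  then obtain N M where N: "\<And>i q. i < length ys \<Longrightarrow> agree N p q \<Longrightarrow> eval q (gs ! i) xs (ys ! i)"
    and M: "\<And>q. agree M p q \<Longrightarrow> eval q f ys z" using eval_Comp.IH by auto
  have "eval q (Comp f gs) xs z" if "agree (max M N) p q" for q
  proof (rule eval.eval_Comp)
    show "list_all2 (\<lambda>g. eval q g xs) gs ys"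
      using N agree_mono[OF that] len by (auto simp: list_all2_conv_all_nth)
    show "eval q f ys z" using M agree_mono[OF that] by simp
  qed
  then show ?case by blast
next
  case (eval_PrimRec_Suc f g n xs y z)
  then obtain N M where N: "\<And>q. agree N p q \<Longrightarrow> eval q (PrimRec f g) (n # xs) y"
    and M: "\<And>q. agree M p q \<Longrightarrow> eval q g (n # y # xs) z" by auto
  have "eval q (PrimRec f g) (Suc n # xs) z" if "agree (max M N) p q" for q
    using N[of q] M[of q] agree_mono[OF that] by (intro eval.eval_PrimRec_Suc) auto
  then show ?case by blast
next
  case (eval_Mu f n xs)
  then obtain y M where y: "\<And>m. m < n \<Longrightarrow> \<exists>N. \<forall>q. agree N p q \<longrightarrow> eval q f (m # xs) (Suc (y m))"
    and M: "\<And>q. agree M p q \<Longrightarrow> eval q f (n # xs) 0" by metis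
  have "\<exists>N. \<forall>m\<in>{..<n}. \<forall>q. agree N p q \<longrightarrow> eval q f (m # xs) (Suc (y m))"
    by (rule finite_common_bound) (auto simp: y intro: agree_mono)
  then obtain N where N: "\<And>m q. m < n \<Longrightarrow> agree N p q \<Longrightarrow> eval q f (m # xs) (Suc (y m))" by auto
  have "eval q (Mu f) xs n" if "agree (max M N) p q" for q
    using N[of _ q] M[of q] agree_mono[OF that] by (intro eval.eval_Mu) auto
  then show ?case by blast
qed (auto intro: eval.intros)

section \<open>Cylinders of closed choice instances\<close>

definition valid :: "baire \<Rightarrow> bool" where
  "valid p \<longleftrightarrow> (\<exists>n. Suc n \<notin> range p)"

text \<open>An enumeration determines the set \<open>A\<close>, so the quantifiers over
  \<open>A\<close> collapse and \<open>valid\<close> describes the domain.\<close>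

lemma C_N_eq: "C_N p = (if valid p then Some {q. Suc (q 0) \<notin> range p} else None)"
proof -
  have enum: "enumerates p (- A) \<longleftrightarrow> A = {n. Suc n \<notin> range p}" for A
    unfolding enumerates_def by blast
  show ?thesis unfolding C_N_def enum valid_def by simp
qed

lemma dom_C_N: "p \<in> dom C_N \<longleftrightarrow> valid p"
  by (simp add: C_N_eq domIff)

text \<open>These are the conditions of the construction: the instances with a given finite prefix.
  The \<open>p\<close> supplying the prefix may itself be invalid.\<close>

definition cylinder :: "baire set \<Rightarrow> bool" where
  "cylinder Z \<longleftrightarrow> (\<exists>N p. Z = {q. valid q \<and> agree N p q})"

lemma cylinder_nonempty:
  assumes "cylinder Z" shows "Z \<noteq> {}"
proof -
  obtain N p where Z: "Z = {q. valid q \<and> agree N p q}" using assms unfolding cylinder_def by blast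
  \<comment> \<open>Padding with \<open>0\<close> enumerates nothing further, so only finitely many
    numbers are ever excluded.\<close>
  define q where "q n = (if n < N then p n else 0)" for n
  have "range q \<subseteq> insert 0 (p ` {..<N})" unfolding q_def by auto
  then have "finite (range q)" by (rule finite_subset) simp
  moreover have "infinite (range Suc)" by (simp add: finite_image_iff)
  ultimately have "valid q" unfolding valid_def by (metis finite_subset image_subsetI)
  moreover have "agree N p q" unfolding q_def agree_def by simp
  ultimately show ?thesis using Z by blast
qed

text \<open>Any number can still be put into the enumerated set after a finite prefix, even if it is
  a correct answer for \<open>p\<close>.\<close>

lemma cylinder_enumerate:
  assumes "cylinder Z" "p \<in> Z"
  shows "\<exists>Z'\<subseteq>Z. cylinder Z' \<and> (\<forall>q\<in>Z'. agree N p q \<and> Suc a \<in> range q)"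
proof -
  obtain M r where Z: "Z = {q. valid q \<and> agree M r q}" using assms unfolding cylinder_def by blast
  \<comment> \<open>Position \<open>K\<close> lies beyond both the prefix that defines
    \<open>Z\<close> and the part of \<open>p\<close> to be preserved. The entry
    \<open>Suc a\<close> placed there enumerates \<open>a\<close>.\<close>
  define K where "K = max M N"
  define Z' where "Z' = {q. valid q \<and> agree (Suc K) (p(K := Suc a)) q}"
  have q: "agree K p q \<and> q K = Suc a" if "q \<in> Z'" for q
    using that unfolding Z'_def agree_def by (auto simp: less_Suc_eq)
  have "q \<in> Z" if "q \<in> Z'" for q
  proof -
    have "agree M p q" using q[OF that] agree_mono unfolding K_def by fastforce
    moreover have "agree M r p" using assms(2) Z by simp
    ultimately show ?thesis using that agree_trans unfolding Z Z'_def by blast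
  qed
  moreover have "agree N p q \<and> Suc a \<in> range q" if "q \<in> Z'" for q
    using q[OF that] agree_mono[of K p q N] unfolding K_def by (metis max.cobounded2 rangeI)
  moreover have "cylinder Z'" unfolding cylinder_def Z'_def by blast
  ultimately show ?thesis by blast
qed

section \<open>The diagonalization\<close>

text \<open>The leading entry \<open>k\<close> shifts the nested joins by one: \<open>D\<close>
  occupies the positions 1 modulo 4, \<open>R\<close> those 3 modulo 4, and \<open>c\<close> the
  positive even ones.\<close>

lemma triple_code_nth:
  "triple_code D R c k 0 = k"
  "triple_code D R c k (4 * x + 1) = of_bool (x \<in> D)"
  "triple_code D R c k (2 * x + 2) = c x"
  "triple_code D R c k (4 * prod_encode (x, y) + 3) = of_bool ((x, y) \<in> R)"
proof -
  have "4 * m + 3 = Suc (2 * (2 * m + 1))" "4 * m + 1 = Suc (2 * (2 * m))" for m :: nat by simp_all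
  note idx = this
  show "triple_code D R c k 0 = k" by (simp add: triple_code_def)
  show "triple_code D R c k (4 * x + 1) = of_bool (x \<in> D)"
    unfolding idx by (simp add: triple_code_def join_def char_fun_def)
  show "triple_code D R c k (2 * x + 2) = c x" by (simp add: triple_code_def join_def)
  have "prod_encode (x, y) \<in> prod_encode ` R \<longleftrightarrow> (x, y) \<in> R"
    by (rule inj_image_mem_iff[OF inj_prod_encode])
  then show "triple_code D R c k (4 * prod_encode (x, y) + 3) = of_bool ((x, y) \<in> R)"
    unfolding idx by (simp add: triple_code_def join_def char_fun_def)
qed

text \<open>A supposed reduction, with the computed triple split into components depending on
  \<open>p\<close>. The backward program is run at input 0 because the first entry carries the
  chosen number.\<close>

locale ind_rat_reduction =
  fixes d e :: prog
    and D :: "baire \<Rightarrow> nat set" and R :: "baire \<Rightarrow> nat rel" and c :: "baire \<Rightarrow> baire" and k :: "baire \<Rightarrow> nat"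
  assumes inst: "valid p \<Longrightarrow> ind_rat_instance (D p) (R p) (c p) (k p)"
    and forward: "valid p \<Longrightarrow> eval p d [n] (triple_code (D p) (R p) (c p) (k p) n)"
    and backward: "valid p \<Longrightarrow> ind_rat_solution (D p) (R p) (c p) B \<Longrightarrow>
      \<exists>a. Suc a \<notin> range p \<and> eval (p \<oplus>\<^sub>B char_fun B) e [0] a"
begin

lemma dlo_instance: "valid p \<Longrightarrow> dlo (R p) (D p)"
  using inst unfolding ind_rat_instance_def presentation_rat_def by (blast intro: iso_rat_imp_dlo)

lemma colour_instance: "valid p \<Longrightarrow> c p ` D p \<subseteq> {..<k p}"
  using inst unfolding ind_rat_instance_def by blast

lemma solutionI:
  "B \<subseteq> D p \<Longrightarrow> \<forall>x\<in>B. c p x = i \<Longrightarrow> dlo (R p) B \<Longrightarrow> ind_rat_solution (D p) (R p) (c p) B"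
  unfolding ind_rat_solution_def using dlo_imp_iso_rat by blast

section \<open>Finite parts of the computed instance\<close>

definition same_on :: "nat set \<Rightarrow> baire \<Rightarrow> baire \<Rightarrow> bool" where
  "same_on X p q \<longleftrightarrow> k q = k p \<and> (\<forall>x\<in>X. (x \<in> D q \<longleftrightarrow> x \<in> D p) \<and> c q x = c p x) \<and>
     (\<forall>x\<in>X. \<forall>y\<in>X. (x, y) \<in> R q \<longleftrightarrow> (x, y) \<in> R p)"

text \<open>The data on \<open>X\<close> occupy finitely many positions of the code, and each of
  these entries is computed from a finite part of \<open>p\<close>.\<close>

lemma instance_continuous:
  assumes "valid p" "finite X"
  shows "\<exists>N. \<forall>q. valid q \<longrightarrow> agree N p q \<longrightarrow> same_on X p q"
proof -
  let ?code = "\<lambda>p. triple_code (D p) (R p) (c p) (k p)"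
  define I where "I = {0} \<union> (\<lambda>x. 4 * x + 1) ` X \<union> (\<lambda>x. 2 * x + 2) ` X \<union>
    (\<lambda>(x, y). 4 * prod_encode (x, y) + 3) ` (X \<times> X)"
  have "\<exists>N. \<forall>n\<in>I. \<forall>q. valid q \<longrightarrow> agree N p q \<longrightarrow> ?code q n = ?code p n"
  proof (rule finite_common_bound)
    show "finite I" using assms(2) unfolding I_def by simp
    fix n
    obtain N where "\<And>q. agree N p q \<Longrightarrow> eval q d [n] (?code p n)"
      using eval_use[OF forward[OF assms(1)]] by blast
    then show "\<exists>N. \<forall>q. valid q \<longrightarrow> agree N p q \<longrightarrow> ?code q n = ?code p n"
      using forward eval_deterministic by blast
  qed (blast intro: agree_mono)
  then obtain N where N: "\<And>n q. n \<in> I \<Longrightarrow> valid q \<Longrightarrow> agree N p q \<Longrightarrow> ?code q n = ?code p n" by blast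
  have "same_on X p q" if q: "valid q" "agree N p q" for q
    unfolding same_on_def
  proof (intro conjI ballI)
    show "k q = k p" using N[OF _ q, of 0] by (simp add: I_def triple_code_nth)
    fix x assume x: "x \<in> X"
    have "4 * x + 1 \<in> I" "2 * x + 2 \<in> I" using x unfolding I_def by blast+
    from this[THEN N[OF _ q]] show "x \<in> D q \<longleftrightarrow> x \<in> D p" "c q x = c p x"
      unfolding triple_code_nth by (simp_all only: of_bool_eq_iff)
    fix y assume "y \<in> X"
    then have "4 * prod_encode (x, y) + 3 \<in> I" using x unfolding I_def by auto
    from N[OF this q] show "(x, y) \<in> R q \<longleftrightarrow> (x, y) \<in> R p"
      unfolding triple_code_nth by (simp only: of_bool_eq_iff)
  qed
  then show ?thesis by blast
qed

section \<open>Copies of one colour in intervals\<close>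

definition cut_in :: "baire \<Rightarrow> nat set \<Rightarrow> nat set \<Rightarrow> bool" where
  "cut_in p L U \<longleftrightarrow> L \<subseteq> D p \<and> U \<subseteq> D p \<and> (\<forall>l\<in>L. \<forall>u\<in>U. (l, u) \<in> R p)"

text \<open>In contrast to \<open>cut_in\<close> for finite sets, this concerns the whole interval
  and is not transferred between instances that agree on finite parts only.\<close>

definition has_copy :: "baire \<Rightarrow> nat set \<Rightarrow> nat set \<Rightarrow> nat \<Rightarrow> bool" where
  "has_copy p L U i \<longleftrightarrow>
     (\<exists>C\<subseteq>gap (R p) (D p) L U. dlo (R p) C \<and> (\<forall>x\<in>C. c p x = i))"

lemma has_copy_mono: "has_copy p (L \<union> L') (U \<union> U') i \<Longrightarrow> has_copy p L U i"
proof -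
  have "gap (R p) (D p) (L \<union> L') (U \<union> U') \<subseteq> gap (R p) (D p) L U" unfolding gap_def by blast
  then show "has_copy p (L \<union> L') (U \<union> U') i \<Longrightarrow> has_copy p L U i"
    unfolding has_copy_def by (meson subset_trans)
qed

text \<open>Indivisibility applied to the gap; it gives the base case of
  \<open>escape\<close>.\<close>

lemma ex_has_copy:
  assumes "valid p" "finite L" "finite U" "cut_in p L U"
  shows "\<exists>i<k p. has_copy p L U i"
proof -
  have "dlo (R p) (gap (R p) (D p) L U)"
    using assms(4) unfolding cut_in_def by (intro dlo_gap dlo_instance assms(1-3)) auto
  moreover have "c p ` gap (R p) (D p) L U \<subseteq> {..<k p}"
    using colour_instance[OF assms(1)] unfolding gap_def by auto
  ultimately show ?thesis
    using dlo_monochromatic[of "{..<k p}"] unfolding has_copy_def by (metis finite_lessThan lessThan_iff)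
qed

lemma has_copy_colour:
  assumes "valid p" "has_copy p L U i" shows "i < k p"
proof -
  obtain C where C: "C \<subseteq> gap (R p) (D p) L U" "dlo (R p) C" "\<forall>x\<in>C. c p x = i"
    using assms(2) unfolding has_copy_def by blast
  then obtain x where "x \<in> C" using dlo_nonempty by blast
  then have "x \<in> D p" "c p x = i" using C unfolding gap_def by auto
  then show ?thesis using colour_instance[OF assms(1)] by auto
qed

text \<open>If every interval left by \<open>F\<close> had a copy of colour \<open>i\<close>, gluing
  these copies to \<open>F\<close> would give a solution that looks like \<open>C\<close> below
  \<open>N\<close>. The backward program would again answer \<open>a\<close>, which \<open>q\<close>
  enumerates as wrong.\<close>

lemma no_wrong_solution:
  assumes "valid q" and F: "F \<subseteq> D q" "F \<subseteq> {..<N}" "\<forall>x\<in>F. c q x = i"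
    and C: "C \<inter> {..<N} = F"
    and use: "\<And>r. agree N (p \<oplus>\<^sub>B char_fun C) r \<Longrightarrow> eval r e [0] a"
    and q: "agree N p q" "Suc a \<in> range q"
  shows "\<exists>G\<subseteq>F. (\<forall>x\<in>G. \<forall>y\<in>F - G. (x, y) \<in> R q) \<and> \<not> has_copy q (L \<union> G) (U \<union> (F - G)) i"
proof (rule ccontr)
  define I where "I = {G. G \<subseteq> F \<and> (\<forall>x\<in>G. \<forall>y\<in>F - G. (x, y) \<in> R q)}"
  assume "\<not> ?thesis"
  then have "\<forall>G\<in>I. \<exists>E\<subseteq>gap (R q) (D q) (L \<union> G) (U \<union> (F - G)). dlo (R q) E \<and> (\<forall>x\<in>E. c q x = i)"
    unfolding I_def has_copy_def by blast
  then obtain E where E: "\<And>G. G \<in> I \<Longrightarrow> E G \<subseteq> gap (R q) (D q) (L \<union> G) (U \<union> (F - G))"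
    "\<And>G. G \<in> I \<Longrightarrow> dlo (R q) (E G)" "\<And>G x. G \<in> I \<Longrightarrow> x \<in> E G \<Longrightarrow> c q x = i"
    by metis
  \<comment> \<open>Numbers below \<open>N\<close> are dropped from the copies, so that
    \<open>B\<close> and \<open>C\<close> have the same part \<open>F\<close> below
    \<open>N\<close>.\<close>
  define B where "B = F \<union> (\<Union>G\<in>I. E G - {..<N})"
  have "dlo (R q) B"
    unfolding B_def I_def
  proof (rule dlo_glue[OF dlo_instance[OF assms(1)] F(1)])
    fix G assume "G \<subseteq> F" "\<forall>x\<in>G. \<forall>y\<in>F - G. (x, y) \<in> R q"
    then have G: "G \<in> I" unfolding I_def by blast
    have "E G - {..<N} \<subseteq> gap (R q) (D q) G (F - G)" using E(1)[OF G] unfolding gap_def by auto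
    then show "dlo (R q) (E G - {..<N}) \<and> E G - {..<N} \<subseteq> gap (R q) (D q) G (F - G)"
      using dlo_remove[OF _ E(2)[OF G], of "{..<N}"] by simp
  qed
  moreover have "E G \<subseteq> D q" if "G \<in> I" for G using E(1)[OF that] unfolding gap_def by blast
  then have "B \<subseteq> D q" using F(1) unfolding B_def by blast
  moreover have "\<forall>x\<in>B. c q x = i" using F(3) E(3) unfolding B_def by blast
  ultimately have "ind_rat_solution (D q) (R q) (c q) B" by (intro solutionI)
  then obtain b where b: "Suc b \<notin> range q" "eval (q \<oplus>\<^sub>B char_fun B) e [0] b"
    using backward[OF assms(1)] by blast
  have "B \<inter> {..<N} = F" using F(2) unfolding B_def by auto
  then have "agree N (char_fun C) (char_fun B)" using C unfolding agree_def char_fun_def by auto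
  then have "eval (q \<oplus>\<^sub>B char_fun B) e [0] a" by (intro use agree_join q(1))
  then have "a = b" using b(2) by (rule eval_deterministic)
  then show False using b(1) q(2) by simp
qed

text \<open>The colour outside \<open>S\<close> may vary with \<open>p\<close>; no uniform choice on
  \<open>Z\<close> is demanded.\<close>

definition escapes :: "nat set \<Rightarrow> nat set \<Rightarrow> nat set \<Rightarrow> baire set \<Rightarrow> bool" where
  "escapes S L U Z \<longleftrightarrow> (\<forall>p\<in>Z. \<exists>i. i \<notin> S \<and> has_copy p L U i)"

text \<open>The cuts are treated one after the other, since shrinking the cylinder preserves what
  was achieved for earlier cuts. The premise \<open>step\<close> is the induction hypothesis of
  \<open>escape\<close>.\<close>

lemma escapes_family:
  assumes step: "\<And>Z L U. cylinder Z \<Longrightarrow> finite L \<Longrightarrow> finite U \<Longrightarrow> \<forall>p\<in>Z. cut_in p L U \<Longrightarrow>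
      \<exists>Z'\<subseteq>Z. cylinder Z' \<and> escapes S L U Z'"
    and "finite I" "cylinder Z"
    and "\<And>G. G \<in> I \<Longrightarrow> finite (L G) \<and> finite (U G) \<and> (\<forall>p\<in>Z. cut_in p (L G) (U G))"
  shows "\<exists>Z'\<subseteq>Z. cylinder Z' \<and> (\<forall>G\<in>I. escapes S (L G) (U G) Z')"
  using assms(2-)
proof (induction rule: finite_induct)
  case (insert G I)
  then obtain Z1 where Z1: "Z1 \<subseteq> Z" "cylinder Z1" "\<forall>G\<in>I. escapes S (L G) (U G) Z1" by auto
  have "finite (L G)" "finite (U G)" "\<forall>p\<in>Z1. cut_in p (L G) (U G)"
    using insert.prems(2)[of G] Z1(1) by auto
  then obtain Z2 where Z2: "Z2 \<subseteq> Z1" "cylinder Z2" "escapes S (L G) (U G) Z2"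
    using step[OF Z1(2)] by metis
  have "escapes S (L G) (U G) Z2" if "G \<in> I" for G
    using Z1(3) that Z2(1) unfolding escapes_def by blast
  then show ?case using Z2 Z1(1) by (intro exI[of _ Z2]) auto
qed auto

text \<open>The cylinder and the cut are kept arbitrary in the induction on \<open>S\<close>,
  because the step applies the hypothesis to later cylinders and to all subintervals.\<close>

lemma escape:
  assumes "finite S" "cylinder Z" "finite L" "finite U" "\<forall>p\<in>Z. cut_in p L U"
  shows "\<exists>Z'\<subseteq>Z. cylinder Z' \<and> escapes S L U Z'"
  using assms
proof (induction arbitrary: Z L U rule: finite_induct)
  case empty
  have "p \<in> Z \<Longrightarrow> valid p" for p using empty.prems(1) unfolding cylinder_def by blast
  then have "escapes {} L U Z"
    using ex_has_copy empty.prems unfolding escapes_def by blast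
  then show ?case using empty.prems(1) by blast
next
  case (insert i S)
  obtain Z1 where Z1: "Z1 \<subseteq> Z" "cylinder Z1" "escapes S L U Z1"
    using insert.IH[OF insert.prems] by blast
  show ?case
  proof (cases "\<exists>p\<in>Z1. has_copy p L U i")
    case False
    then have "escapes (insert i S) L U Z1" using Z1(3) unfolding escapes_def by (metis insert_iff)
    then show ?thesis using Z1 by blast
  next
    case True
    have validZ: "valid q" if "q \<in> Z1" for q using that Z1(2) unfolding cylinder_def by blast
    obtain p C where p: "p \<in> Z1" and C: "C \<subseteq> gap (R p) (D p) L U" "dlo (R p) C" "\<forall>x\<in>C. c p x = i"
      using True unfolding has_copy_def by blast
    have CD: "C \<subseteq> D p" using C(1) unfolding gap_def by blast
    obtain a where "Suc a \<notin> range p" and "eval (p \<oplus>\<^sub>B char_fun C) e [0] a"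
      using backward[OF validZ[OF p] solutionI[OF CD C(3,2)]] by blast
    \<comment> \<open>The bound \<open>N\<close> is the use of the computation of \<open>a\<close>,
      so only the part \<open>F\<close> of the solution \<open>C\<close> can have influenced
      it.\<close>
    then obtain N where N: "\<And>r. agree N (p \<oplus>\<^sub>B char_fun C) r \<Longrightarrow> eval r e [0] a"
      using eval_use by blast
    define F where "F = C \<inter> {..<N}"
    define I where "I = {G. G \<subseteq> F \<and> (\<forall>x\<in>G. \<forall>y\<in>F - G. (x, y) \<in> R p)}"
    have fin: "finite F" "finite I" unfolding F_def I_def by auto
    have "finite (F \<union> L \<union> U)" using fin(1) insert.prems(2,3) by simp
    then obtain M where M: "\<And>q. valid q \<Longrightarrow> agree M p q \<Longrightarrow> same_on (F \<union> L \<union> U) p q"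
      using instance_continuous[OF validZ[OF p]] by metis
    \<comment> \<open>Agreement below \<open>M\<close> keeps the order and colours on
      \<open>F\<close>, \<open>L\<close> and \<open>U\<close>; agreement below \<open>N\<close>
      keeps the computation; and \<open>a\<close> becomes a wrong answer.\<close>
    obtain Z2 where Z2: "Z2 \<subseteq> Z1" "cylinder Z2" "\<And>q. q \<in> Z2 \<Longrightarrow> agree (max M N) p q \<and> Suc a \<in> range q"
      using cylinder_enumerate[OF Z1(2) p, of "max M N" a] by metis
    have agr: "agree M p q" "agree N p q" if "q \<in> Z2" for q
      using Z2(3)[OF that] by (auto elim: agree_mono)
    have same: "same_on (F \<union> L \<union> U) p q" if "q \<in> Z2" for q
      using M[OF validZ agr(1)] Z2(1) that by blast
    have D: "x \<in> D q \<longleftrightarrow> x \<in> D p" and c: "c q x = c p x" if "q \<in> Z2" "x \<in> F \<union> L \<union> U" for q x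
      using same[OF that(1)] that(2) unfolding same_on_def by simp_all
    have R: "(x, y) \<in> R q \<longleftrightarrow> (x, y) \<in> R p" if "q \<in> Z2" "x \<in> F \<union> L \<union> U" "y \<in> F \<union> L \<union> U" for q x y
      using same[OF that(1)] that(2,3) unfolding same_on_def by simp
    have FC: "F \<subseteq> gap (R p) (D p) L U" using C(1) unfolding F_def by blast
    have p_cut: "cut_in p L U" using insert.prems(4) Z1(1) p by blast
    have cuts: "finite (L \<union> G) \<and> finite (U \<union> (F - G)) \<and> (\<forall>q\<in>Z2. cut_in q (L \<union> G) (U \<union> (F - G)))"
      if G: "G \<in> I" for G
    proof (intro conjI ballI)
      have GF: "G \<subseteq> F" using G unfolding I_def by blast
      then show "finite (L \<union> G)" "finite (U \<union> (F - G))"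
        using fin(1) insert.prems(2,3) by (auto intro: finite_subset)
      fix q assume q: "q \<in> Z2"
      have "cut_in p (L \<union> G) (U \<union> (F - G))"
        using p_cut FC G GF unfolding cut_in_def gap_def I_def by auto
      moreover have "L \<union> G \<subseteq> F \<union> L \<union> U" "U \<union> (F - G) \<subseteq> F \<union> L \<union> U" using GF by auto
      ultimately show "cut_in q (L \<union> G) (U \<union> (F - G))"
        unfolding cut_in_def using D[OF q] R[OF q] by (meson subset_iff)
    qed
    \<comment> \<open>All intervals are treated in advance, because the one without colour
      \<open>i\<close> is known only once \<open>q\<close> is given.\<close>
    have "\<exists>Z3\<subseteq>Z2. cylinder Z3 \<and> (\<forall>G\<in>I. escapes S (L \<union> G) (U \<union> (F - G)) Z3)"
      by (rule escapes_family[OF insert.IH fin(2) Z2(2) cuts])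
    then obtain Z3 where Z3: "Z3 \<subseteq> Z2" "cylinder Z3" "\<forall>G\<in>I. escapes S (L \<union> G) (U \<union> (F - G)) Z3"
      by blast
    have "\<exists>j. j \<notin> insert i S \<and> has_copy q L U j" if "q \<in> Z3" for q
    proof -
      have q: "q \<in> Z2" using that Z3(1) by blast
      have "\<exists>G\<subseteq>F. (\<forall>x\<in>G. \<forall>y\<in>F - G. (x, y) \<in> R q) \<and> \<not> has_copy q (L \<union> G) (U \<union> (F - G)) i"
      proof (rule no_wrong_solution[OF _ _ _ _ _ N])
        show "valid q" using validZ Z2(1) q by blast
        show "F \<subseteq> D q" using FC D[OF q] unfolding gap_def by blast
        show "\<forall>x\<in>F. c q x = i" using c[OF q] C(3) unfolding F_def by simp
        show "agree N p q" "Suc a \<in> range q" using agr(2)[OF q] Z2(3)[OF q] by auto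
      qed (auto simp: F_def)
      then obtain G where G: "G \<subseteq> F" "\<forall>x\<in>G. \<forall>y\<in>F - G. (x, y) \<in> R q"
        and no: "\<not> has_copy q (L \<union> G) (U \<union> (F - G)) i" by blast
      have "G \<in> I" using G R[OF q] unfolding I_def by blast
      then obtain j where "j \<notin> S" "has_copy q (L \<union> G) (U \<union> (F - G)) j"
        using Z3(3) \<open>q \<in> Z3\<close> unfolding escapes_def by blast
      \<comment> \<open>The interval has a copy of colour \<open>j\<close> but none of colour
        \<open>i\<close>, so \<open>j\<close> differs from \<open>i\<close>; the copy also lies in
        the larger gap of \<open>L\<close> and \<open>U\<close>.\<close>
      then show ?thesis using no has_copy_mono by (metis insert_iff)
    qed
    then have "escapes (insert i S) L U Z3" unfolding escapes_def by blast
    then show ?thesis using Z1(1) Z2(1) Z3(1,2) by (meson subset_trans)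
  qed
qed

lemma contradiction: False
proof -
  define p0 :: baire where "p0 = (\<lambda>_. 0)"
  have p0: "valid p0" unfolding valid_def p0_def by auto
  \<comment> \<open>Even for the empty set of points, \<open>same_on\<close> fixes the number of
    colours, so all of \<open>Z\<close> has \<open>k p0\<close> colours.\<close>
  obtain N where N: "\<And>q. valid q \<Longrightarrow> agree N p0 q \<Longrightarrow> k q = k p0"
    using instance_continuous[OF p0, of "{}"] unfolding same_on_def by auto
  define Z where "Z = {q. valid q \<and> agree N p0 q}"
  have "cylinder Z" unfolding cylinder_def Z_def by blast
  \<comment> \<open>With \<open>L\<close> and \<open>U\<close> empty the gap is the whole order, and
    all available colours are to be escaped.\<close>
  then obtain Z' where Z': "Z' \<subseteq> Z" "cylinder Z'" "escapes {..<k p0} {} {} Z'"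
    using escape[of "{..<k p0}" Z "{}" "{}"] unfolding cut_in_def by auto
  obtain q where q: "q \<in> Z'" using cylinder_nonempty[OF Z'(2)] by blast
  then obtain i where "i \<notin> {..<k p0}" "has_copy q {} {} i" using Z'(3) unfolding escapes_def by blast
  moreover have "valid q" "k q = k p0" using q Z'(1) N unfolding Z_def by auto
  ultimately show False using has_copy_colour[of q "{}" "{}" i] by simp
qed

end

theorem theorem4p1:
  shows "\<not> C_N \<le>\<^sub>W Ind_Q"
proof
  assume "C_N \<le>\<^sub>W Ind_Q"
  then obtain \<Delta> \<Psi> where func: "turing_functional \<Delta>" "turing_functional \<Psi>"
    and red: "\<And>p. p \<in> dom C_N \<Longrightarrow> \<exists>d\<in>dom Ind_Q. \<Delta> p = Some d \<and>
      (\<forall>q\<in>the (Ind_Q d). \<exists>r\<in>the (C_N p). \<Psi> (p \<oplus>\<^sub>B q) = Some r)"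
    unfolding weihrauch_le_def by blast
  obtain d e where d: "\<And>p f n. \<Delta> p = Some f \<Longrightarrow> eval p d [n] (f n)"
    and e: "\<And>p f n. \<Psi> p = Some f \<Longrightarrow> eval p e [n] (f n)"
    using func unfolding turing_functional_def by metis
  \<comment> \<open>Once this holds for each valid \<open>p\<close>, choosing the four components as
    functions of \<open>p\<close> yields the assumptions of the locale.\<close>
  have "\<exists>D R c k. ind_rat_instance D R c k \<and> (\<forall>n. eval p d [n] (triple_code D R c k n)) \<and>
      (\<forall>B. ind_rat_solution D R c B \<longrightarrow>
        (\<exists>a. Suc a \<notin> range p \<and> eval (p \<oplus>\<^sub>B char_fun B) e [0] a))" if p: "valid p" for p
  proof -
    have dom: "p \<in> dom C_N" using p by (simp add: dom_C_N)
    obtain f where f: "f \<in> dom Ind_Q" "\<Delta> p = Some f"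
      and sol: "\<And>q. q \<in> the (Ind_Q f) \<Longrightarrow> \<exists>r\<in>the (C_N p). \<Psi> (p \<oplus>\<^sub>B q) = Some r"
      using red[OF dom] by blast
    obtain D R c k where code: "f = triple_code D R c k" "ind_rat_instance D R c k"
      using f(1) unfolding Ind_Q_def by (auto split: if_splits)
    have "\<exists>a. Suc a \<notin> range p \<and> eval (p \<oplus>\<^sub>B char_fun B) e [0] a" if B: "ind_rat_solution D R c B" for B
    proof -
      have "char_fun B \<in> {char_fun B |B. \<exists>D R c k. f = triple_code D R c k \<and> ind_rat_solution D R c B}"
        using B code(1) by blast
      then have "char_fun B \<in> the (Ind_Q f)" using code unfolding Ind_Q_def by (subst if_P) auto
      then obtain r where "r \<in> the (C_N p)" "\<Psi> (p \<oplus>\<^sub>B char_fun B) = Some r" using sol by blast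
      then show ?thesis using e p by (auto simp: C_N_eq)
    qed
    then show ?thesis using code d[OF f(2)] by blast
  qed
  then obtain D R c k where "ind_rat_reduction d e D R c k"
    unfolding ind_rat_reduction_def by metis
  then show False by (rule ind_rat_reduction.contradiction)
qed

end
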